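(* Let $n, m$ be positive integers, and let $F_1$ and $F_2$ be two factorizations of the identity $1_{S_n}$ of the symmetric group $S_n$, each with $m$ factors, where every factor is either a transposition or $1_{S_n}$. Then $F_1$ and $F_2$ are Hurwitz equivalent if and only if the graphs $G_{F_1}$ and $G_{F_2}$ have the same number $d$ of connected components, denoted $G_{F_1}^1,\dots,G_{F_1}^d$ and $G_{F_2}^1,\dots,G_{F_2}^d$ respectively, and there exists a permutation $\pi$ of $\{1,\dots,d\}$ such that $V_{F_1}^i = V_{F_2}^{\pi(i)}$ and $W(G_{F_1}^i) = W(G_{F_2}^{\pi(i)})$ for every $1\le i \leq d$.
   Context: A factorization $F=\Gamma_1\cdots\Gamma_m$ of an element $g$ of a group $G$ is an ordered tuple $(\Gamma_1,\dots,\Gamma_m)\in G^m$ whose product is $g$. Hurwitz moves: for $1\le k\le m-1$, the tuple $(s_1,\dots,s_m)\in G^m$ is obtained from $(t_1,\dots,t_m)\in G^m$ by the Hurwitz move $R_k$ (and $(t_1,\dots,t_m)$ is obtained from $(s_1,\dots,s_m)$ by $R_k^{-1}$) if $s_i=t_i$ for $i\ne k,k+1$, $s_k=t_kt_{k+1}t_k^{-1}$ and $s_{k+1}=t_k$. Two factorizations are Hurwitz equivalent if one is obtained from the other by a finite sequence of Hurwitz moves $R_k^{\pm1}$. Let $F=\Gamma_1\cdots\Gamma_m$ be a factorization in $S_n$ with each $\Gamma_k$ a transposition or $1_{S_n}$. Its graph $G_F=(V_F,E_F)$ is the undirected graph with vertex set $V_F=\{1,\dots,n\}$ and edge set $E_F=\{(i,j):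 \exists k \text{ with } \Gamma_k=(i,j)\}$, where $(i,j)$, $i\neq j$, denotes a transposition, regarded as the undirected edge between $i$ and $j$ (factors equal to $1_{S_n}$ contribute no edge). The weight $W_F((i,j))$ of an edge is the number of indices $k$ with $\Gamma_k=(i,j)$. The connected components of $G_F$ are denoted $G_F^i=(V_F^i,E_F^i)$, and the weight of a component is $W(G_F^i)=\sum_{e\in E_F^i}W_F(e)$ (so an isolated vertex is a component of weight $0$). *)

theory Defs
  imports "HOL-Algebra.Sym_Groups"
begin

definition factorization :: "('a, 'b) monoid_scheme \<Rightarrow> 'a \<Rightarrow> 'a list \<Rightarrow> bool" where
  "factorization G g ts \<longleftrightarrow> set ts \<subseteq> carrier G \<and> foldr (mult G) ts (one G) = g"

text \<open>
  Tuples are lists, so the entry at position \<open>k\<close> of a list is the \<open>(k + 1)\<close>-st entry of the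
  tuple. \<open>hurwitz_move G k t s\<close> says that \<open>s\<close> is obtained from \<open>t\<close> by the move usually
  written \<open>R\<close> with index \<open>k + 1\<close>.
\<close>

definition hurwitz_move :: "('a, 'b) monoid_scheme \<Rightarrow> nat \<Rightarrow> 'a list \<Rightarrow> 'a list \<Rightarrow> bool" where
  "hurwitz_move G k t s \<longleftrightarrow>
     set t \<subseteq> carrier G \<and> set s \<subseteq> carrier G \<and>
     length s = length t \<and> Suc k < length t \<and>
     (\<forall>i < length t. i \<noteq> k \<and> i \<noteq> Suc k \<longrightarrow> s ! i = t ! i) \<and>
     s ! k = t ! k \<otimes>\<^bsub>G\<^esub> t ! Suc k \<otimes>\<^bsub>G\<^esub> inv\<^bsub>G\<^esub> (t ! k) \<and>
     s ! Suc k = t ! k"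

definition hurwitz_equivalent :: "('a, 'b) monoid_scheme \<Rightarrow> 'a list \<Rightarrow> 'a list \<Rightarrow> bool" where
  "hurwitz_equivalent G = (\<lambda>t s. \<exists>k. hurwitz_move G k t s \<or> hurwitz_move G k s t)\<^sup>*\<^sup>*"

text \<open>The edge between \<open>i\<close> and \<open>j\<close> of an undirected graph is the set \<open>{i, j}\<close>.\<close>

definition is_transposition_of :: "nat \<Rightarrow> (nat \<Rightarrow> nat) \<Rightarrow> nat set \<Rightarrow> bool" where
  "is_transposition_of n p e \<longleftrightarrow>
     (\<exists>i \<in> {1..n}. \<exists>j \<in> {1..n}. i \<noteq> j \<and> e = {i, j} \<and> p = transpose i j)"

definition is_transposition :: "nat \<Rightarrow> (nat \<Rightarrow> nat) \<Rightarrow> bool" where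
  "is_transposition n p \<longleftrightarrow> (\<exists>e. is_transposition_of n p e)"

type_synonym ugraph = "nat set \<times> nat set set"

definition fact_graph :: "nat \<Rightarrow> (nat \<Rightarrow> nat) list \<Rightarrow> ugraph" where
  "fact_graph n F = ({1..n}, {e. \<exists>k < length F. is_transposition_of n (F ! k) e})"

definition edge_weight :: "nat \<Rightarrow> (nat \<Rightarrow> nat) list \<Rightarrow> nat set \<Rightarrow> nat" where
  "edge_weight n F e = card {k. k < length F \<and> is_transposition_of n (F ! k) e}"

definition reachable :: "ugraph \<Rightarrow> nat rel" where
  "reachable G =
     {(u, v). u \<in> fst G \<and> v \<in> fst G \<and> (\<lambda>x y. {x, y} \<in> snd G)\<^sup>*\<^sup>* u v}"

definition connected_components :: "ugraph \<Rightarrow> ugraph set" where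
  "connected_components G = (\<lambda>C. (C, {e \<in> snd G. e \<subseteq> C})) ` (fst G // reachable G)"

definition component_weight :: "nat \<Rightarrow> (nat \<Rightarrow> nat) list \<Rightarrow> ugraph \<Rightarrow> nat" where
  "component_weight n F C = (\<Sum>e \<in> snd C. edge_weight n F e)"

end

theory Submission
  imports Defs
begin

text \<open>
  Call a transposition or the identity a letter, and a list of letters a word. Let \<open>C(x)\<close> be the
  component of a point \<open>x\<close> in the graph of a word, and let its weight be the number of letters that
  move a point of \<open>C(x)\<close>. A Hurwitz move conjugates one letter by another letter of the word. It
  therefore changes neither the partition of the points into components nor the weights; this is
  one direction of the theorem (\<open>hurwitz_eq_conn\<close>, \<open>hurwitz_eq_weight\<close>).

  For the converse, a vertex \<open>v\<close> that lies on some edge is split off. Every letter that moves \<open>v\<close>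
  can be brought to the front, and whenever two neighbouring letters \<open>(v x)\<close> and \<open>(v y)\<close> with
  \<open>x \<noteq> y\<close> occur there, a Hurwitz move turns one of them into \<open>(x y)\<close>, so that fewer letters move
  \<open>v\<close>. With the least possible number of such letters the word is \<open>(v x)\<^sup>p U\<close>, where all letters of
  \<open>U\<close> fix \<open>v\<close> (\<open>star_constant\<close>). As the product is the identity, \<open>p\<close> is even (\<open>star_pairs\<close>).

  The second idea is that a pair \<open>a a\<close> of equal letters has product \<open>1\<close>, hence can be moved
  anywhere without changing the other letters, and can be conjugated by any other letter of the
  word (\<open>pair_pass\<close>, \<open>pair_conj\<close>). So if some letter of \<open>U\<close> moves \<open>x\<close>, all but one of the pairs
  \<open>(v x)(v x)\<close> can be made to fix \<open>v\<close> (\<open>star_single_pair\<close>), and the remaining pair can be carried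
  along a path of \<open>U\<close> to \<open>(v r)(v r)\<close> for any prescribed \<open>r\<close> in the component of \<open>v\<close>
  (\<open>pair_move_end\<close>). The outcome is \<open>peel_vertex\<close>.

  If two words of the same length have the same components and weights, then peeling the same \<open>v\<close>
  with the same \<open>r\<close> from both leaves the same number of pairs \<open>(v r)(v r)\<close> in front: one pair if the
  component has more than the two vertices \<open>v\<close> and \<open>r\<close>, and otherwise as many as the weight
  prescribes. The remaining words are shorter, and their components and weights are again determined
  by the original ones, so induction on the length applies (\<open>hurwitz_eq_if_same_invariants\<close>).
\<close>

section \<open>Transpositions and the identity as letters\<close>

text \<open>
  Allowing \<open>x = y\<close> includes the identity, provided that \<open>S\<close> is nonempty. Both kinds of factor then
  obey the same laws: they are involutions, and conjugation permutes them.
\<close>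

definition swaps :: "'a set \<Rightarrow> ('a \<Rightarrow> 'a) set" where
  "swaps S = {transpose x y |x y. x \<in> S \<and> y \<in> S}"

lemma transpose_in_swaps: "x \<in> S \<Longrightarrow> y \<in> S \<Longrightarrow> transpose x y \<in> swaps S"
  unfolding swaps_def by blast

lemma swaps_involutory: "a \<in> swaps S \<Longrightarrow> a \<circ> a = id"
  by (auto simp: swaps_def)

lemma swaps_involutory_apply [simp]: "a \<in> swaps S \<Longrightarrow> a (a x) = x"
  by (auto simp: swaps_def)

lemma conj_transpose:
  assumes "a \<in> swaps S"
  shows "a \<circ> transpose x y \<circ> a = transpose (a x) (a y)"
proof
  fix z
  have "inj a"
    using assms by (metis injI swaps_involutory_apply)
  then show "(a \<circ> transpose x y \<circ> a) z = transpose (a x) (a y) z"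
    using assms by (auto simp: transpose_def)
qed

lemma swaps_apply_mem: "a \<in> swaps S \<Longrightarrow> x \<in> S \<Longrightarrow> a x \<in> S"
  by (auto simp: swaps_def transpose_def)

lemma conj_swaps: "a \<in> swaps S \<Longrightarrow> b \<in> swaps S \<Longrightarrow> a \<circ> b \<circ> a \<in> swaps S"
proof -
  assume a: "a \<in> swaps S" and "b \<in> swaps S"
  then obtain x y where b: "x \<in> S" "y \<in> S" "b = transpose x y" by (auto simp: swaps_def)
  then have "a \<circ> b \<circ> a = transpose (a x) (a y)" using conj_transpose[OF a] by simp
  with b swaps_apply_mem[OF a] show ?thesis unfolding swaps_def by blast
qed

lemma conj_conj: "a \<circ> a = id \<Longrightarrow> a \<circ> (a \<circ> b \<circ> a) \<circ> a = b"
  by (auto simp: fun_eq_iff)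

lemma conj_swaps_iff: "a \<in> swaps S \<Longrightarrow> a \<circ> b \<circ> a \<in> swaps S \<longleftrightarrow> b \<in> swaps S"
  using conj_swaps[of a S b] conj_swaps[of a S "a \<circ> b \<circ> a"] conj_conj[of a b] swaps_involutory[of a S]
  by auto

lemma swaps_eq_transpose:
  assumes "a \<in> swaps S" "a x \<noteq> x"
  shows "a = transpose x (a x)"
proof -
  obtain y z where "a = transpose y z" using assms(1) by (auto simp: swaps_def)
  then show ?thesis using assms(2) by (metis transpose_commute transpose_apply_first
        transpose_apply_other transpose_apply_second)
qed

section \<open>Hurwitz moves on words\<close>

text \<open>
  For an involution \<open>a\<close> this is the usual move, with the inverse of \<open>a\<close> replaced by \<open>a\<close>; on words
  over \<open>swaps S\<close> no ambient group is therefore mentioned.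
\<close>

definition hurwitz_step :: "('a \<Rightarrow> 'a) list \<Rightarrow> ('a \<Rightarrow> 'a) list \<Rightarrow> bool" where
  "hurwitz_step s t \<longleftrightarrow> (\<exists>u a b v. s = u @ a # b # v \<and> t = u @ (a \<circ> b \<circ> a) # a # v)"

abbreviation hurwitz_eq (infix "\<simeq>" 50) where
  "s \<simeq> t \<equiv> equivclp hurwitz_step s t"

lemma hurwitz_eq_trans [trans]: "s \<simeq> t \<Longrightarrow> t \<simeq> u \<Longrightarrow> s \<simeq> u"
  by (rule equivclp_trans)

lemma hurwitz_eq_refl [simp, intro]: "s \<simeq> s"
  by simp

lemma hurwitz_step_append: "hurwitz_step s t \<Longrightarrow> hurwitz_step (u @ s @ v) (u @ t @ v)"
  unfolding hurwitz_step_def by (metis append.assoc append_Cons)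

lemma hurwitz_eq_append:
  assumes "s \<simeq> t" shows "u @ s @ v \<simeq> u @ t @ v"
  using assms
proof (induction rule: equivclp_induct)
  case (step y z)
  have "u @ y @ v \<simeq> u @ z @ v"
    using step(2) hurwitz_step_append[of y z u v] hurwitz_step_append[of z y u v]
    by (metis r_into_equivclp equivclp_sym)
  with step.IH show ?case by (rule hurwitz_eq_trans)
qed simp

lemma hurwitz_eq_append_left: "s \<simeq> t \<Longrightarrow> u @ s \<simeq> u @ t"
  using hurwitz_eq_append[of s t u "[]"] by simp

lemma hurwitz_eq_Cons: "s \<simeq> t \<Longrightarrow> a # s \<simeq> a # t"
  using hurwitz_eq_append_left[of s t "[a]"] by simp

lemma move_right: "a # b # v \<simeq> (a \<circ> b \<circ> a) # a # v"
proof -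
  have "hurwitz_step (a # b # v) ((a \<circ> b \<circ> a) # a # v)"
    unfolding hurwitz_step_def by (intro exI[of _ "[]"]) auto
  then show ?thesis by (rule r_into_equivclp)
qed

lemma move_left: "b \<circ> b = id \<Longrightarrow> a # b # v \<simeq> b # (b \<circ> a \<circ> b) # v"
  using equivclp_sym[OF move_right[of b "b \<circ> a \<circ> b" v]] by (simp add: conj_conj)

section \<open>Components, weights and the product are invariants\<close>

text \<open>
  A transposition takes \<open>x\<close> to a different point \<open>y\<close> exactly if it is the edge between them, and
  fixed points only add loops. So the reflexive transitive closure of this relation is
  connectedness in the graph of the word.
\<close>

definition letter_step :: "('a \<Rightarrow> 'a) list \<Rightarrow> 'a \<Rightarrow> 'a \<Rightarrow> bool" where
  "letter_step W x y \<longleftrightarrow> (\<exists>t\<in>set W. t x = y)"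

abbreviation conn :: "('a \<Rightarrow> 'a) list \<Rightarrow> 'a \<Rightarrow> 'a \<Rightarrow> bool" where
  "conn W \<equiv> (letter_step W)\<^sup>*\<^sup>*"

text \<open>
  Counting the letters that meet the component of \<open>x\<close> avoids sums over edges: both ends of an edge
  lie in the same component, and identity letters move nothing.
\<close>

definition weight :: "('a \<Rightarrow> 'a) list \<Rightarrow> 'a \<Rightarrow> nat" where
  "weight W x = length (filter (\<lambda>t. \<exists>y. t y \<noteq> y \<and> conn W x y) W)"

lemma conn_letter: "t \<in> set W \<Longrightarrow> conn W x (t x)"
  by (rule r_into_rtranclp) (auto simp: letter_step_def)

lemma conn_sym:
  assumes "set W \<subseteq> swaps S" "conn W x y" shows "conn W y x"
proof -
  have "symp (letter_step W)"
    using assms(1) by (auto intro!: sympI simp: letter_step_def subset_iff)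
      (metis swaps_involutory_apply)
  then show ?thesis using assms(2) by (metis symp_rtranclp sympD)
qed

lemma conn_conv:
  assumes "\<And>t x. t \<in> set W \<Longrightarrow> conn U x (t x)" "conn W x y"
  shows "conn U x y"
  using assms(2)
proof (induction rule: rtranclp_induct)
  case (step y z)
  then obtain t where "t \<in> set W" "t y = z" by (auto simp: letter_step_def)
  then have "conn U y z" using assms(1) by blast
  with step.IH show ?case by (rule rtranclp_trans)
qed simp

lemma hurwitz_step_swaps:
  assumes "hurwitz_step s t" "set s \<subseteq> swaps S \<or> set t \<subseteq> swaps S"
  shows "set s \<subseteq> swaps S" "set t \<subseteq> swaps S"
  using assms by (auto simp: hurwitz_step_def conj_swaps_iff conj_swaps)

lemma hurwitz_eq_swaps: "s \<simeq> t \<Longrightarrow> set s \<subseteq> swaps S \<Longrightarrow> set t \<subseteq> swaps S"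
  by (induction rule: equivclp_induct) (auto dest: hurwitz_step_swaps)

text \<open>
  Each of \<open>b\<close> and \<open>a b a\<close> is a path of three steps through \<open>a\<close> and the other one, so the two words
  connect the same points.
\<close>

lemma hurwitz_step_conn:
  assumes "hurwitz_step s t" "set s \<subseteq> swaps S"
  shows "conn s = conn t"
proof -
  from assms obtain u a b v where st: "s = u @ a # b # v" "t = u @ (a \<circ> b \<circ> a) # a # v"
    by (auto simp: hurwitz_step_def)
  have inv: "a (a x) = x" for x using assms(2) st by auto
  have ta: "conn t x (a x)" for x by (rule conn_letter) (simp add: st)
  have tc: "conn t x ((a \<circ> b \<circ> a) x)" for x by (rule conn_letter) (simp add: st del: comp_apply)
  have sa: "conn s x (a x)" for x by (rule conn_letter) (simp add: st)
  have sb: "conn s x (b x)" for x by (rule conn_letter) (simp add: st)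
  have tb: "conn t x (b x)" for x
    using rtranclp_trans[OF rtranclp_trans[OF ta[of x] tc] ta] by (simp add: inv)
  have sc: "conn s x ((a \<circ> b \<circ> a) x)" for x
    using rtranclp_trans[OF rtranclp_trans[OF sa[of x] sb] sa] by simp
  have "conn t x (c x)" if "c \<in> set s" for c x
  proof (cases "c = b")
    case False
    with that show ?thesis by (intro conn_letter) (auto simp: st)
  qed (simp add: tb)
  moreover have "conn s x (c x)" if "c \<in> set t" for c x
  proof (cases "c = a \<circ> b \<circ> a")
    case False
    with that show ?thesis by (intro conn_letter) (auto simp: st)
  next
    case True
    then show ?thesis using sc[of x] by simp
  qed
  ultimately have "conn s x y \<longleftrightarrow> conn t x y" for x y
    using conn_conv[of s t x y] conn_conv[of t s x y] by auto
  then show ?thesis by (intro ext)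
qed

text \<open>
  The points moved by \<open>a b a\<close> are the images under \<open>a\<close> of the points moved by \<open>b\<close>, and \<open>a\<close> maps
  every component to itself.
\<close>

lemma hurwitz_step_weight:
  assumes "hurwitz_step s t" "set s \<subseteq> swaps S"
  shows "weight s = weight t"
proof
  fix x
  from assms obtain u a b v where st: "s = u @ a # b # v" "t = u @ (a \<circ> b \<circ> a) # a # v"
    by (auto simp: hurwitz_step_def)
  have inv: "a (a x) = x" for x using assms(2) st by auto
  have c: "conn s = conn t" by (rule hurwitz_step_conn[OF assms])
  have ca: "conn s y (a y)" for y by (rule conn_letter) (simp add: st)
  have "(\<exists>y. (a \<circ> b \<circ> a) y \<noteq> y \<and> conn s x y) \<longleftrightarrow> (\<exists>y. b y \<noteq> y \<and> conn s x y)"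
    (is "?L \<longleftrightarrow> ?R")
  proof
    assume ?L
    then obtain y where y: "a (b (a y)) \<noteq> y" "conn s x y" by auto
    have "b (a y) \<noteq> a y" using y(1) inv[of y] by auto
    moreover have "conn s x (a y)" using y(2) ca by (rule rtranclp_trans)
    ultimately show ?R by auto
  next
    assume ?R
    then obtain y where y: "b y \<noteq> y" "conn s x y" by auto
    have "a (b y) \<noteq> a y" using y(1) inv[of "b y"] inv[of y] by auto
    then have "(a \<circ> b \<circ> a) (a y) \<noteq> a y" by (simp add: inv)
    moreover have "conn s x (a y)" using y(2) ca by (rule rtranclp_trans)
    ultimately show ?L by blast
  qed
  then show "weight s x = weight t x"
    unfolding weight_def c[symmetric] by (simp add: st)
qed

lemma hurwitz_step_prod:
  assumes "hurwitz_step s t" "set s \<subseteq> swaps S"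
  shows "foldr (\<circ>) s id = foldr (\<circ>) t id"
proof -
  from assms obtain u a b v where st: "s = u @ a # b # v" "t = u @ (a \<circ> b \<circ> a) # a # v"
    by (auto simp: hurwitz_step_def)
  then have "a (a x) = x" for x using assms(2) by auto
  then have "a \<circ> (b \<circ> foldr (\<circ>) v id) = (a \<circ> b \<circ> a) \<circ> (a \<circ> foldr (\<circ>) v id)"
    by (simp add: fun_eq_iff)
  then show ?thesis by (simp add: st)
qed

lemma hurwitz_eq_length: "s \<simeq> t \<Longrightarrow> length s = length t"
  by (induction rule: equivclp_induct) (auto simp: hurwitz_step_def)

lemma hurwitz_eq_invariant:
  assumes "\<And>s t. hurwitz_step s t \<Longrightarrow> set s \<subseteq> swaps S \<Longrightarrow> f s = f t"
    and "s \<simeq> t" "set s \<subseteq> swaps S"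
  shows "f s = f t"
  using assms(2)
proof (induction rule: equivclp_induct)
  case (step y z)
  have "set y \<subseteq> swaps S" using step(1) assms(3) by (rule hurwitz_eq_swaps)
  with step(2) have "f y = f z"
    using assms(1)[of y z] assms(1)[of z y] hurwitz_step_swaps[of y z S] hurwitz_step_swaps[of z y S]
    by auto
  with step.IH show ?case by simp
qed simp

lemma hurwitz_eq_conn:
  "s \<simeq> t \<Longrightarrow> set s \<subseteq> swaps S \<Longrightarrow> conn s = conn t"
  by (rule hurwitz_eq_invariant[OF hurwitz_step_conn])

lemma hurwitz_eq_weight:
  "s \<simeq> t \<Longrightarrow> set s \<subseteq> swaps S \<Longrightarrow> weight s = weight t"
  by (rule hurwitz_eq_invariant[OF hurwitz_step_weight])

lemma hurwitz_eq_prod: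
  "s \<simeq> t \<Longrightarrow> set s \<subseteq> swaps S \<Longrightarrow> foldr (\<circ>) s id = foldr (\<circ>) t id"
  by (rule hurwitz_eq_invariant[OF hurwitz_step_prod])

section \<open>Pairs of equal letters\<close>

text \<open>
  Moving a letter to the left over \<open>a a\<close> conjugates it twice by the involution \<open>a\<close>, hence does not
  change it.
\<close>

lemma pair_pass:
  assumes "a \<circ> a = id" shows "a # a # w @ v \<simeq> w @ a # a # v"
proof (induction w)
  case (Cons b w)
  have "a # a # b # w @ v \<simeq> a # (a \<circ> b \<circ> a) # a # w @ v"
    by (rule hurwitz_eq_Cons) (rule move_right)
  also have "\<dots> \<simeq> (a \<circ> (a \<circ> b \<circ> a) \<circ> a) # a # a # w @ v"
    by (rule move_right)
  also have "\<dots> = b # a # a # w @ v"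
    by (simp only: conj_conj[OF assms])
  also have "\<dots> \<simeq> b # w @ a # a # v"
    using Cons by (rule hurwitz_eq_Cons)
  finally show ?case by simp
qed simp

text \<open>
  The pair is carried next to \<open>b\<close>, where moving \<open>b\<close> over it to the left conjugates both of its
  letters; the new pair is then carried back to the front.
\<close>

lemma pair_conj:
  assumes "a \<circ> a = id" "b \<circ> b = id" "b \<in> set w"
  shows "a # a # w \<simeq> (b \<circ> a \<circ> b) # (b \<circ> a \<circ> b) # w"
proof -
  let ?c = "b \<circ> a \<circ> b"
  have c: "?c \<circ> ?c = id" using assms(1,2) by (simp add: fun_eq_iff)
  obtain w1 w2 where w: "w = w1 @ b # w2" using assms(3) by (metis split_list)
  have "a # a # w \<simeq> w1 @ a # a # b # w2"
    using pair_pass[OF assms(1)] by (simp add: w)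
  also have "\<dots> \<simeq> w1 @ a # b # ?c # w2"
    by (intro hurwitz_eq_append_left hurwitz_eq_Cons move_left assms)
  also have "\<dots> \<simeq> w1 @ b # ?c # ?c # w2"
    by (intro hurwitz_eq_append_left move_left assms)
  also have "\<dots> \<simeq> ?c # ?c # w"
    using equivclp_sym[OF pair_pass[OF c, of "w1 @ [b]" w2]] by (simp add: w)
  finally show ?thesis .
qed

text \<open>
  Conjugation by a letter \<open>t\<close> that fixes \<open>v\<close> turns \<open>(v y)\<close> into \<open>(v (t y))\<close>, so the free end of the
  pair follows any path of \<open>w\<close>, while \<open>w\<close> itself does not change.
\<close>

lemma pair_move_end:
  assumes "set w \<subseteq> swaps S" "\<And>t. t \<in> set w \<Longrightarrow> t v = v" "conn w x y"
  shows "transpose v x # transpose v x # w \<simeq> transpose v y # transpose v y # w"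
  using assms(3)
proof (induction rule: rtranclp_induct)
  case (step y z)
  then obtain t where t: "t \<in> set w" "t y = z" by (auto simp: letter_step_def)
  then have ts: "t \<in> swaps S" using assms(1) by auto
  have "transpose v y # transpose v y # w \<simeq> transpose v z # transpose v z # w"
    using pair_conj[of "transpose v y" t w] t ts conj_transpose[OF ts, of v y] assms(2)[of t]
    by (simp add: swaps_involutory)
  with step.IH show ?case by (rule hurwitz_eq_trans)
qed simp

section \<open>Collecting the letters that move a vertex\<close>

lemma conn_fixed:
  assumes "\<And>t. t \<in> set W \<Longrightarrow> t v = v" "conn W v y"
  shows "y = v"
  using assms(2) by (induction rule: rtranclp_induct) (auto simp: letter_step_def assms(1))

lemma weight_fixed:
  assumes "\<And>t. t \<in> set W \<Longrightarrow> t v = v"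
  shows "weight W v = 0"
  using assms conn_fixed[of W v] by (auto simp: weight_def filter_empty_conv)

lemma star_pass:
  assumes "a \<in> swaps S" "a v = v"
  shows "a # map (transpose v) xs @ U \<simeq> map (transpose v) (map a xs) @ a # U"
proof (induction xs)
  case (Cons x xs)
  have "a # transpose v x # map (transpose v) xs @ U
      \<simeq> (a \<circ> transpose v x \<circ> a) # a # map (transpose v) xs @ U"
    by (rule move_right)
  also have "\<dots> = transpose v (a x) # a # map (transpose v) xs @ U"
    by (simp only: conj_transpose[OF assms(1)] assms(2))
  also have "\<dots> \<simeq> transpose v (a x) # map (transpose v) (map a xs) @ a # U"
    using Cons by (rule hurwitz_eq_Cons)
  finally show ?case by simp
qed simp

lemma swaps_apply_neq_fixed: "a \<in> swaps S \<Longrightarrow> a v = v \<Longrightarrow> x \<noteq> v \<Longrightarrow> a x \<noteq> v"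
  by (metis swaps_involutory_apply)

lemma fixed_notin_map: "a \<in> swaps S \<Longrightarrow> a v = v \<Longrightarrow> v \<notin> set xs \<Longrightarrow> v \<notin> set (map a xs)"
  by (metis image_iff set_map swaps_apply_neq_fixed)

text \<open>
  Letters fixing \<open>v\<close> move to the right over letters \<open>(v x)\<close>, which keep their end \<open>v\<close> when they are
  conjugated.
\<close>

lemma star_gather:
  assumes "set W \<subseteq> swaps S"
  shows "\<exists>xs U. W \<simeq> map (transpose v) xs @ U \<and> v \<notin> set xs \<and> (\<forall>t \<in> set U. t v = v)"
  using assms
proof (induction W)
  case Nil
  show ?case by (intro exI[of _ "[]"]) simp
next
  case (Cons a W)
  then obtain xs U where IH: "W \<simeq> map (transpose v) xs @ U" "v \<notin> set xs" "\<forall>t \<in> set U. t v = v"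
    by auto
  have a: "a \<in> swaps S" using Cons.prems by simp
  have W: "a # W \<simeq> a # map (transpose v) xs @ U"
    using IH(1) by (rule hurwitz_eq_Cons)
  show ?case
  proof (cases "a v = v")
    case True
    have "a # W \<simeq> map (transpose v) (map a xs) @ a # U"
      using W star_pass[OF a True] by (rule hurwitz_eq_trans)
    moreover have "v \<notin> set (map a xs)"
      using fixed_notin_map[OF a True IH(2)] .
    moreover have "\<forall>t \<in> set (a # U). t v = v" using IH(3) True by simp
    ultimately show ?thesis by blast
  next
    case False
    then have "a # map (transpose v) xs @ U = map (transpose v) (a v # xs) @ U"
      using swaps_eq_transpose[OF a] by simp
    moreover have "v \<notin> set (a v # xs)" using False IH(2) by auto
    ultimately show ?thesis
      using W IH(3) by (intro exI[of _ "a v # xs"] exI[of _ U]) simp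
  qed
qed

text \<open>
  The dichotomy behind the descent in \<open>star_constant\<close>.
\<close>

lemma constant_or_adjacent_distinct:
  obtains x where "xs = replicate (length xs) x"
  | p x y q where "xs = p @ x # y # q" "x \<noteq> y"
proof (induction xs arbitrary: thesis)
  case (Cons x xs)
  show ?case
  proof (cases xs)
    case Nil
    then show ?thesis using Cons.prems(1)[of x] by simp
  next
    case (Cons y ys)
    note xs = this
    show ?thesis
    proof (rule Cons.IH)
      fix z assume z: "xs = replicate (length xs) z"
      then have "y = z" "ys = replicate (length ys) z" using xs by simp_all
      then show ?thesis
        using xs Cons.prems(1)[of x] Cons.prems(2)[of "[]" x y ys] by (cases "x = y") auto
    next
      fix p x' y' q assume "xs = p @ x' # y' # q" "x' \<noteq> y'"
      then show ?thesis using Cons.prems(2)[of "x # p" x' y' q] by simp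
    qed
  qed
qed simp

text \<open>
  Among all words of the form provided by \<open>star_gather\<close>, one with the fewest letters moving \<open>v\<close> is
  chosen. If two neighbours \<open>(v x)\<close> and \<open>(v y)\<close> among these letters differed, the move that
  conjugates the second by the first would turn it into \<open>(x y)\<close>, which fixes \<open>v\<close>. The second
  alternative of the conclusion covers words that do not move \<open>v\<close> at all, for which a suitable
  \<open>x \<noteq> v\<close> need not exist.
\<close>

lemma star_constant:
  assumes W: "set W \<subseteq> swaps S"
  shows "\<exists>p x U. W \<simeq> replicate p (transpose v x) @ U \<and> x \<noteq> v \<and> (\<forall>t \<in> set U. t v = v)
          \<or> W \<simeq> U \<and> (\<forall>t \<in> set U. t v = v)"
proof -
  define P where "P xs U \<longleftrightarrow> W \<simeq> map (transpose v) xs @ U \<and> v \<notin> set xs \<and> (\<forall>t \<in> set U. t v = v)"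
    for xs U
  have "\<exists>k xs U. length xs = k \<and> P xs U" using star_gather[OF W] by (auto simp: P_def)
  then obtain k where k: "\<exists>xs U. length xs = k \<and> P xs U"
    and min: "\<forall>l < k. \<not> (\<exists>xs U. length xs = l \<and> P xs U)"
    by (subst (asm) exists_least_iff) blast
  then obtain xs U where xs: "length xs = k" "P xs U" by blast
  show ?thesis
  proof (rule constant_or_adjacent_distinct[of xs])
    fix x assume x: "xs = replicate (length xs) x"
    show ?thesis
    proof (cases "xs = []")
      case True
      then show ?thesis using xs(2) by (auto simp: P_def)
    next
      case False
      then have "x \<in> set xs" using x by (metis in_set_replicate length_0_conv)
      then have "x \<noteq> v" using xs(2) by (auto simp: P_def)
      moreover have "map (transpose v) xs = replicate (length xs) (transpose v x)"
        by (subst x) simp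
      ultimately show ?thesis using xs(2) unfolding P_def by auto
    qed
  next
    fix p x y q assume pq: "xs = p @ x # y # q" "x \<noteq> y"
    let ?a = "transpose x y" and ?T = "map (transpose v)"
    have v: "x \<noteq> v" "y \<noteq> v" "v \<notin> set p" "v \<notin> set q" using xs(2) pq by (auto simp: P_def)
    have a: "?a \<in> swaps UNIV" "?a v = v" using v by (simp_all add: transpose_in_swaps)
    have "transpose v x \<circ> transpose v y \<circ> transpose v x = ?a"
      using conj_transpose[of "transpose v x" UNIV v y] transpose_in_swaps[of v UNIV x] v pq(2) by simp
    then have "?T xs @ U \<simeq> ?T p @ ?a # transpose v x # ?T q @ U"
      using hurwitz_eq_append_left[OF move_right[of "transpose v x" "transpose v y" "?T q @ U"], of "?T p"]
      by (simp add: pq)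
    also have "\<dots> \<simeq> ?T p @ ?T (map ?a (x # q)) @ ?a # U"
      using hurwitz_eq_append_left[OF star_pass[OF a, of "x # q" U], of "?T p"] by simp
    finally have step: "?T xs @ U \<simeq> ?T (p @ map ?a (x # q)) @ ?a # U" by simp
    have "W \<simeq> ?T xs @ U" using xs(2) by (simp add: P_def)
    then have "W \<simeq> ?T (p @ map ?a (x # q)) @ ?a # U" using step by (rule hurwitz_eq_trans)
    moreover have "v \<notin> set (p @ map ?a (x # q))"
      using v fixed_notin_map[OF a, of "x # q"] by simp
    moreover have "\<forall>t \<in> set (?a # U). t v = v" using xs(2) a by (auto simp: P_def)
    ultimately have "P (p @ map ?a (x # q)) (?a # U)" unfolding P_def by blast
    moreover have "length (p @ map ?a (x # q)) < k" using xs(1) pq by simp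
    ultimately show ?thesis using min by blast
  qed
qed

lemma prod_replicate_even:
  assumes "a \<circ> a = id"
  shows "foldr (\<circ>) (replicate (2 * q) a @ U) id = foldr (\<circ>) U id"
proof -
  have aa: "a (a z) = z" for z using fun_cong[OF assms, of z] by simp
  show ?thesis by (induction q) (simp_all add: fun_eq_iff aa)
qed

lemma prod_fixed: "(\<And>t. t \<in> set U \<Longrightarrow> t v = v) \<Longrightarrow> foldr (\<circ>) U id v = v"
  by (induction U) simp_all

text \<open>
  The letters in \<open>U\<close> fix \<open>v\<close>, so an odd number of factors \<open>(v x)\<close> would make the product take \<open>v\<close> to
  \<open>x\<close>. There is at least one such factor, since otherwise \<open>v\<close> would be isolated in the new word,
  but not in the original one.
\<close>

lemma star_pairs:
  assumes W: "set W \<subseteq> swaps S" and prod: "foldr (\<circ>) W id = id" and t: "t \<in> set W" "t v \<noteq> v"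
  shows "\<exists>q x U. W \<simeq> replicate (2 * Suc q) (transpose v x) @ U \<and> x \<noteq> v \<and> (\<forall>t \<in> set U. t v = v)"
proof -
  have nofix: "\<not> (W \<simeq> U \<and> (\<forall>t \<in> set U. t v = v))" for U
  proof
    assume U: "W \<simeq> U \<and> (\<forall>t \<in> set U. t v = v)"
    then have "conn U v (t v)" using conn_letter[OF t(1), of v] hurwitz_eq_conn[OF _ W, of U] by simp
    then show False using conn_fixed[of U v "t v"] U t(2) by blast
  qed
  then obtain p x U where U: "W \<simeq> replicate p (transpose v x) @ U" "x \<noteq> v" "\<forall>t \<in> set U. t v = v"
    using star_constant[OF W, of v] by blast
  have "even p"
  proof (rule ccontr)
    assume "odd p"
    then obtain q where "p = Suc (2 * q)" by (elim oddE) simp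
    then have "id v = foldr (\<circ>) (transpose v x # replicate (2 * q) (transpose v x) @ U) id v"
      using hurwitz_eq_prod[OF U(1) W] prod by simp
    also have "\<dots> = transpose v x (foldr (\<circ>) U id v)"
      using prod_replicate_even[of "transpose v x" q U] by simp
    also have "\<dots> = x" using prod_fixed[of U v] U(3) by simp
    finally show False using U(2) by simp
  qed
  moreover have "p \<noteq> 0"
  proof
    assume "p = 0"
    then have "W \<simeq> U" using U(1) by simp
    then show False using nofix[of U] U(3) by blast
  qed
  ultimately have "p = 2 * Suc (p div 2 - 1)" by (auto elim!: evenE)
  then obtain q where "p = 2 * Suc q" ..
  then show ?thesis using U by blast
qed

text \<open>
  If \<open>t\<close> in \<open>U\<close> takes \<open>x\<close> to \<open>y \<noteq> x\<close>, a surplus pair \<open>(v x)(v x)\<close> is conjugated first by \<open>t\<close>, giving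
  \<open>(v y)(v y)\<close>, and then by one of the other letters \<open>(v x)\<close>, giving \<open>(x y)(x y)\<close>, which fixes \<open>v\<close>
  and joins \<open>U\<close>.
\<close>

lemma star_single_pair:
  assumes "\<forall>t \<in> set U. t v = v" "x \<noteq> v" "t \<in> set U" "t x \<noteq> x" "set U \<subseteq> swaps UNIV"
  shows "\<exists>U'. replicate (2 * Suc k) (transpose v x) @ U \<simeq> transpose v x # transpose v x # U' \<and>
              (\<forall>t \<in> set U'. t v = v)"
  using assms(1,3,5)
proof (induction k arbitrary: U)
  case 0
  then show ?case by (intro exI[of _ U]) (simp add: numeral_2_eq_2)
next
  case (Suc k)
  let ?a = "transpose v x" and ?y = "t x"
  let ?c = "transpose x ?y"
  have t: "t \<in> swaps UNIV" "t v = v" using Suc.prems by auto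
  have y: "?y \<noteq> v" using swaps_apply_neq_fixed[OF t assms(2)] .
  have a: "?a \<circ> ?a = id" and tt: "t \<circ> t = id" using swaps_involutory[OF t(1)] by auto
  have vy: "t \<circ> ?a \<circ> t = transpose v ?y" using conj_transpose[OF t(1), of v x] t(2) by simp
  have xy: "?a \<circ> transpose v ?y \<circ> ?a = ?c"
    using conj_transpose[of ?a UNIV v ?y] transpose_in_swaps[of v UNIV x] y assms(4) by simp
  let ?R = "replicate (2 * Suc k) ?a @ U"
  have tR: "t \<in> set ?R" and aR: "?a \<in> set ?R" using Suc.prems(2) by simp_all
  have "replicate (2 * Suc (Suc k)) ?a @ U \<simeq> transpose v ?y # transpose v ?y # ?R"
    using pair_conj[OF a tt tR] unfolding vy by simp
  also have "\<dots> \<simeq> ?c # ?c # ?R"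
    using pair_conj[OF transpose_comp_involutory a aR, of v ?y] unfolding xy .
  also have "\<dots> \<simeq> replicate (2 * Suc k) ?a @ ?c # ?c # U"
    by (rule pair_pass) simp
  finally have 1: "replicate (2 * Suc (Suc k)) ?a @ U \<simeq> replicate (2 * Suc k) ?a @ ?c # ?c # U" .
  have "?c v = v" using y assms(2) by simp
  moreover have "?c \<in> swaps UNIV" by (simp add: transpose_in_swaps)
  then have "set (?c # ?c # U) \<subseteq> swaps UNIV" using Suc.prems(3) by simp
  ultimately have "\<exists>U'. replicate (2 * Suc k) ?a @ ?c # ?c # U \<simeq> ?a # ?a # U' \<and> (\<forall>t \<in> set U'. t v = v)"
    using Suc.prems(1,2) by (intro Suc.IH) simp_all
  then obtain U' where "replicate (2 * Suc k) ?a @ ?c # ?c # U \<simeq> ?a # ?a # U'"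
    "\<forall>t \<in> set U'. t v = v"
    by blast
  then show ?case by (intro exI[of _ U'] conjI hurwitz_eq_trans[OF 1])
qed

section \<open>Splitting off a vertex\<close>

text \<open>
  Contracting the edge between \<open>v\<close> and \<open>r\<close> maps every path of the whole word to a path of \<open>U\<close>.
\<close>

lemma conn_contract:
  assumes "\<forall>t \<in> set U. t v = v" "set U \<subseteq> swaps S" "r \<noteq> v"
    and "conn (replicate p (transpose v r) @ U) a b"
  shows "conn U (if a = v then r else a) (if b = v then r else b)"
  using assms(4)
proof (induction rule: rtranclp_induct)
  case (step y z)
  let ?\<phi> = "\<lambda>z. if z = v then r else z"
  obtain t where t: "t \<in> set (replicate p (transpose v r) @ U)" "t y = z"
    using step(2) unfolding letter_step_def by blast
  have "conn U (?\<phi> y) (?\<phi> z)"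
  proof (cases "t \<in> set U")
    case True
    show ?thesis
    proof (cases "y = v")
      case True
      then show ?thesis using t assms(1) \<open>t \<in> set U\<close> by auto
    next
      case False
      then have "z \<noteq> v" using swaps_apply_neq_fixed[of t S v y] t assms(1,2) \<open>t \<in> set U\<close> by auto
      then show ?thesis using False conn_letter[OF \<open>t \<in> set U\<close>, of y] t(2) by simp
    qed
  next
    case False
    then have "t = transpose v r" using t(1) by auto
    then have "?\<phi> z = ?\<phi> y" using t(2) assms(3) by (auto simp: transpose_def split: if_splits)
    then show ?thesis by simp
  qed
  with step.IH show ?case by (rule rtranclp_trans)
qed simp

lemma conn_append: "conn U a b \<Longrightarrow> conn (V @ U) a b"
  by (rule conn_conv[of U]) (simp_all add: conn_letter)

text \<open>
  The components of \<open>U\<close> are recovered from those of the whole word by making \<open>v\<close> an isolated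
  vertex: in the graph of the whole word, \<open>v\<close> is joined to no vertex other than \<open>r\<close>, so its removal
  disconnects nothing else.
\<close>

lemma conn_peeled:
  assumes "\<forall>t \<in> set U. t v = v" "set U \<subseteq> swaps S" "r \<noteq> v"
  shows "conn U a b \<longleftrightarrow>
    a = b \<or> a \<noteq> v \<and> b \<noteq> v \<and> conn (replicate p (transpose v r) @ U) a b"
proof
  assume ab: "conn U a b"
  show "a = b \<or> a \<noteq> v \<and> b \<noteq> v \<and> conn (replicate p (transpose v r) @ U) a b"
    using conn_fixed[of U v b] conn_fixed[of U v a] ab conn_sym[OF assms(2) ab]
      conn_append[OF ab] assms(1) by blast
next
  assume "a = b \<or> a \<noteq> v \<and> b \<noteq> v \<and> conn (replicate p (transpose v r) @ U) a b"
  then show "conn U a b"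
    using conn_contract[OF assms, of p a b] by auto
qed

lemma weight_peeled:
  assumes "\<forall>t \<in> set U. t v = v" "set U \<subseteq> swaps S" "r \<noteq> v" "a \<noteq> v" "0 < p"
  shows "weight (replicate p (transpose v r) @ U) a = (if conn U a r then p else 0) + weight U a"
proof -
  let ?W = "replicate p (transpose v r) @ U"
  have conn: "conn ?W a y \<longleftrightarrow> conn U a y" if "y \<noteq> v" for y
    using conn_peeled[OF assms(1-3), of a y p] assms(4) that by auto
  have moved: "(\<exists>y. t y \<noteq> y \<and> conn ?W a y) \<longleftrightarrow> (\<exists>y. t y \<noteq> y \<and> conn U a y)"
    if "t \<in> set U" for t
  proof -
    have "y \<noteq> v" if "t y \<noteq> y" for y using assms(1) \<open>t \<in> set U\<close> that by auto
    then show ?thesis using conn by blast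
  qed
  have "conn ?W r (transpose v r r)" "conn ?W v (transpose v r v)"
    using assms(5) by (intro conn_letter; simp)+
  then have "conn ?W a v \<longleftrightarrow> conn ?W a r" by (auto intro: rtranclp_trans)
  then have "(\<exists>y. transpose v r y \<noteq> y \<and> conn ?W a y) \<longleftrightarrow> conn U a r"
    using conn[OF assms(3)] assms(3) by (auto simp: transpose_def)
  then show ?thesis
    by (auto simp: weight_def moved cong: filter_cong)
qed

text \<open>
  The neighbour \<open>x\<close> found by \<open>star_pairs\<close> is exchanged for \<open>r\<close>. If \<open>x \<noteq> r\<close>, then \<open>U\<close> connects \<open>x\<close>
  with \<open>r\<close>, so it moves \<open>x\<close>; only one pair is in front then, and \<open>pair_move_end\<close> applies.
  The final disjunction makes the number of pairs a function of the components and weights: several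
  pairs remain only if \<open>{v, r}\<close> is a whole component.
\<close>

lemma peel_vertex:
  assumes W: "set W \<subseteq> swaps S" and prod: "foldr (\<circ>) W id = id"
    and vr: "conn W v r" "r \<noteq> v"
  shows "\<exists>q U. W \<simeq> replicate (2 * Suc q) (transpose v r) @ U \<and> (\<forall>t \<in> set U. t v = v) \<and>
           (q = 0 \<or> (\<forall>t \<in> set U. t r = r))"
proof -
  obtain t where "t \<in> set W" "t v \<noteq> v" using conn_fixed[of W v r] vr by blast
  then obtain q0 x U0 where U0: "W \<simeq> replicate (2 * Suc q0) (transpose v x) @ U0" "x \<noteq> v"
    "\<forall>t \<in> set U0. t v = v"
    using star_pairs[OF W prod] by blast
  have U0S: "set U0 \<subseteq> swaps UNIV"
  proof -
    have "set W \<subseteq> swaps UNIV" using W by (fastforce simp: swaps_def)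
    then show ?thesis using hurwitz_eq_swaps[OF U0(1)] by simp
  qed
  obtain q U where U: "W \<simeq> replicate (2 * Suc q) (transpose v x) @ U" "\<forall>t \<in> set U. t v = v"
    "q = 0 \<or> (\<forall>t \<in> set U. t x = x)"
  proof (cases "\<forall>t \<in> set U0. t x = x")
    case False
    then obtain t where "t \<in> set U0" "t x \<noteq> x" by blast
    then obtain U where "replicate (2 * Suc q0) (transpose v x) @ U0 \<simeq> transpose v x # transpose v x # U"
      "\<forall>t \<in> set U. t v = v"
      using star_single_pair[OF U0(3,2) _ _ U0S] by blast
    then show ?thesis using that[of 0 U] hurwitz_eq_trans[OF U0(1)] by (auto simp: numeral_2_eq_2)
  qed (use U0 that in blast)
  show ?thesis
  proof (cases "x = r")
    case False
    have US: "set U \<subseteq> swaps S" using hurwitz_eq_swaps[OF U(1) W] by simp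
    have "conn (replicate (2 * Suc q) (transpose v x) @ U) v r"
      using hurwitz_eq_conn[OF U(1) W] vr(1) by simp
    then have xr: "conn U x r"
      using conn_contract[OF U(2) US U0(2), of "2 * Suc q" v r] vr(2) by simp
    then have q: "q = 0" using conn_fixed[of U x r] U(3) False by blast
    have "transpose v x # transpose v x # U \<simeq> transpose v r # transpose v r # U"
      using U(2) by (intro pair_move_end[OF US _ xr]) simp
    moreover have "W \<simeq> transpose v x # transpose v x # U"
      using U(1) by (simp add: q numeral_2_eq_2)
    ultimately have "W \<simeq> transpose v r # transpose v r # U"
      by (meson hurwitz_eq_trans)
    then show ?thesis using U(2) by (intro exI[of _ 0] exI[of _ U]) (simp add: numeral_2_eq_2)
  qed (use U in blast)
qed

text \<open>
  The same vertex \<open>v\<close> with the same neighbour \<open>r\<close> is split off from both words. Components and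
  weights of a remainder are functions of those of the word, so the two remainders agree in them.
\<close>

lemma hurwitz_eq_if_same_invariants:
  assumes "set W1 \<subseteq> swaps S" "set W2 \<subseteq> swaps S"
    and "length W1 = length W2"
    and "foldr (\<circ>) W1 id = id" "foldr (\<circ>) W2 id = id"
    and "conn W1 = conn W2" "weight W1 = weight W2"
  shows "W1 \<simeq> W2"
  using assms
proof (induction W1 arbitrary: W2 rule: length_induct)
  case (1 W1)
  note W = "1.prems"
  show ?case
  proof (cases "\<forall>t \<in> set W1. t = id")
    case True
    have "t = id" if "t \<in> set W2" for t
    proof
      fix x
      have "conn W1 x (t x)" using conn_letter[OF that, of x] W(6) by simp
      then show "t x = id x" using conn_fixed[of W1 x "t x"] True by fastforce
    qed
    then have "W1 = W2"
      using True W(3) by (metis replicate_length_same)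
    then show ?thesis by simp
  next
    case False
    then obtain t v where t: "t \<in> set W1" "t v \<noteq> v" by (auto simp: fun_eq_iff)
    define r where "r = t v"
    have r: "r \<noteq> v" "conn W1 v r" "conn W2 v r"
      using t conn_letter[OF t(1), of v] W(6) by (simp_all add: r_def)
    obtain q1 U1 where U1: "W1 \<simeq> replicate (2 * Suc q1) (transpose v r) @ U1"
      "\<forall>t \<in> set U1. t v = v" "q1 = 0 \<or> (\<forall>t \<in> set U1. t r = r)"
      using peel_vertex[OF W(1,4) r(2,1)] by blast
    obtain q2 U2 where U2: "W2 \<simeq> replicate (2 * Suc q2) (transpose v r) @ U2"
      "\<forall>t \<in> set U2. t v = v" "q2 = 0 \<or> (\<forall>t \<in> set U2. t r = r)"
      using peel_vertex[OF W(2,5) r(3,1)] by blast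
    have S: "set U1 \<subseteq> swaps S" "set U2 \<subseteq> swaps S"
      using hurwitz_eq_swaps[OF U1(1) W(1)] hurwitz_eq_swaps[OF U2(1) W(2)] by simp_all
    have prod: "foldr (\<circ>) U1 id = id" "foldr (\<circ>) U2 id = id"
      using hurwitz_eq_prod[OF U1(1) W(1)] hurwitz_eq_prod[OF U2(1) W(2)]
      unfolding prod_replicate_even[OF transpose_comp_involutory] W(4,5) by - (rule sym, assumption)+
    have connU: "conn U a b \<longleftrightarrow> a = b \<or> a \<noteq> v \<and> b \<noteq> v \<and> conn V a b"
      if "V \<simeq> replicate (2 * Suc q) (transpose v r) @ U" "set V \<subseteq> swaps S"
        "\<forall>t \<in> set U. t v = v" "set U \<subseteq> swaps S" for U V q a b
      using conn_peeled[OF that(3,4) r(1), of a b "2 * Suc q"]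
      unfolding hurwitz_eq_conn[OF that(1,2)] .
    have weightU: "weight V a = (if conn U a r then 2 * Suc q else 0) + weight U a"
      if "V \<simeq> replicate (2 * Suc q) (transpose v r) @ U" "set V \<subseteq> swaps S"
        "\<forall>t \<in> set U. t v = v" "set U \<subseteq> swaps S" "a \<noteq> v" for U V q a
      using weight_peeled[OF that(3,4) r(1) that(5), of "2 * Suc q"] hurwitz_eq_weight[OF that(1,2)]
      by simp
    have conn: "conn U1 = conn U2"
      using connU[OF U1(1) W(1) U1(2) S(1)] connU[OF U2(1) W(2) U2(2) S(2)] W(6)
      by (intro ext) simp
    have fixed: "(\<forall>t \<in> set U. t r = r) \<longleftrightarrow> (\<forall>y. conn U r y \<longrightarrow> y = r)" for U
      using conn_fixed[of U r] conn_letter[of _ U r] by blast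
    \<comment> \<open>Either \<open>r\<close> is moved in both remainders, and there is one pair in each word, or in neither of
      them, and then the pairs make up the whole weight of the component of \<open>r\<close>.\<close>
    have q: "q1 = q2"
    proof (cases "\<forall>t \<in> set U1. t r = r")
      case True
      then have "\<forall>t \<in> set U2. t r = r" using conn fixed[of U1] fixed[of U2] by simp
      then have "weight U1 r = 0" "weight U2 r = 0"
        using True by (simp_all add: weight_fixed)
      then show ?thesis
        using weightU[OF U1(1) W(1) U1(2) S(1) r(1)] weightU[OF U2(1) W(2) U2(2) S(2) r(1)] W(7)
        by simp
    next
      case False
      then have "\<not> (\<forall>t \<in> set U2. t r = r)" using conn fixed[of U1] fixed[of U2] by simp
      then show ?thesis using False U1(3) U2(3) by blast
    qed
    have weight: "weight U1 = weight U2"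
    proof
      fix a
      show "weight U1 a = weight U2 a"
      proof (cases "a = v")
        case True
        then show ?thesis using U1(2) U2(2) by (simp add: weight_fixed)
      next
        case False
        then show ?thesis
          using weightU[OF U1(1) W(1) U1(2) S(1) False] weightU[OF U2(1) W(2) U2(2) S(2) False]
            W(7) unfolding q conn by simp
      qed
    qed
    have len: "length W1 = 2 * Suc q1 + length U1" "length W2 = 2 * Suc q2 + length U2"
      using hurwitz_eq_length[OF U1(1)] hurwitz_eq_length[OF U2(1)] by simp_all
    have "length U1 < length W1" "length U1 = length U2" using len W(3) q by simp_all
    then have "U1 \<simeq> U2"
      by (rule "1.IH"[rule_format, OF _ S _ prod conn weight])
    then have "replicate (2 * Suc q1) (transpose v r) @ U1 \<simeq> replicate (2 * Suc q2) (transpose v r) @ U2"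
      unfolding q by (rule hurwitz_eq_append_left)
    with U1(1) have "W1 \<simeq> replicate (2 * Suc q2) (transpose v r) @ U2" by (rule hurwitz_eq_trans)
    then show ?thesis using equivclp_sym[OF U2(1)] by (rule hurwitz_eq_trans)
  qed
qed

section \<open>The symmetric group and the graph of a factorization\<close>

lemma swaps_sym_group: "t \<in> swaps {1..n} \<Longrightarrow> t \<in> carrier (sym_group n)"
  by (auto simp: swaps_def sym_group_carrier intro: permutes_swap_id)

lemma inv_swaps: "t \<in> swaps S \<Longrightarrow> inv' t = t"
  by (auto simp: swaps_def)

lemma swaps_fixes_outside: "t \<in> swaps S \<Longrightarrow> x \<notin> S \<Longrightarrow> t x = x"
  by (auto simp: swaps_def transpose_def)

lemma hurwitz_move_of_step:
  assumes "hurwitz_step s t" "set s \<subseteq> swaps {1..n}"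
  shows "\<exists>k. hurwitz_move (sym_group n) k s t"
proof -
  from assms(1) obtain u a b v where st: "s = u @ a # b # v" "t = u @ (a \<circ> b \<circ> a) # a # v"
    by (auto simp: hurwitz_step_def)
  have a: "a \<in> swaps {1..n}" using assms(2) st by simp
  have "set t \<subseteq> swaps {1..n}" using hurwitz_step_swaps assms by blast
  then have "set s \<subseteq> carrier (sym_group n)" "set t \<subseteq> carrier (sym_group n)"
    using assms(2) swaps_sym_group by blast+
  moreover have "inv\<^bsub>sym_group n\<^esub> a = a"
    using swaps_sym_group[OF a] inv_swaps[OF a] by simp
  moreover have "t ! i = s ! i" if "i \<noteq> length u" "i \<noteq> Suc (length u)" for i
    using that by (auto simp: st nth_append nth_Cons split: nat.splits)
  ultimately have "hurwitz_move (sym_group n) (length u) s t"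
    unfolding hurwitz_move_def by (auto simp: st nth_append sym_group_mult)
  then show ?thesis ..
qed

lemma split_at_pair:
  assumes "Suc k < length s"
  shows "s = take k s @ s ! k # s ! Suc k # drop (Suc (Suc k)) s"
  using assms id_take_nth_drop[of k s] Cons_nth_drop_Suc[of "Suc k" s] by simp

text \<open>
  It suffices that one of the two words consists of letters: the factor by which the move conjugates
  occurs in both.
\<close>

lemma hurwitz_step_of_move:
  assumes m: "hurwitz_move (sym_group n) k s t"
    and S: "set s \<subseteq> swaps {1..n} \<or> set t \<subseteq> swaps {1..n}"
  shows "hurwitz_step s t"
proof -
  have len: "length t = length s" "Suc k < length s" using m by (auto simp: hurwitz_move_def)
  have eq: "t ! k = s ! k \<circ> s ! Suc k \<circ> inv\<^bsub>sym_group n\<^esub> (s ! k)" "t ! Suc k = s ! k"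
    "\<And>i. i < length s \<Longrightarrow> i \<noteq> k \<Longrightarrow> i \<noteq> Suc k \<Longrightarrow> t ! i = s ! i"
    using m by (auto simp: hurwitz_move_def sym_group_mult)
  have "s ! k \<in> set s" "s ! k \<in> set t"
    using len eq(2) by (metis Suc_lessD nth_mem)+
  then have a: "s ! k \<in> swaps {1..n}" using S by blast
  have inv: "inv\<^bsub>sym_group n\<^esub> (s ! k) = s ! k"
    using swaps_sym_group[OF a] inv_swaps[OF a] by simp
  have "take k t = take k s" "drop (Suc (Suc k)) t = drop (Suc (Suc k)) s"
    using len eq(3) by (auto intro!: nth_equalityI)
  then have "t = take k s @ (s ! k \<circ> s ! Suc k \<circ> s ! k) # s ! k # drop (Suc (Suc k)) s"
    using split_at_pair[of k t] len eq(1,2) inv by simp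
  then show ?thesis
    using split_at_pair[OF len(2)] unfolding hurwitz_step_def by blast
qed

lemma hurwitz_equivalent_iff:
  assumes "set s \<subseteq> swaps {1..n}"
  shows "hurwitz_equivalent (sym_group n) s t \<longleftrightarrow> s \<simeq> t"
proof
  assume "hurwitz_equivalent (sym_group n) s t"
  then show "s \<simeq> t"
    unfolding hurwitz_equivalent_def
  proof (induction rule: rtranclp_induct)
    case (step y z)
    have y: "set y \<subseteq> swaps {1..n}" using hurwitz_eq_swaps[OF step.IH assms] .
    then have "hurwitz_step y z \<or> hurwitz_step z y"
      using step(2) hurwitz_step_of_move by blast
    then have "y \<simeq> z" by (auto intro: equivclp_sym)
    with step.IH show ?case by (rule hurwitz_eq_trans)
  qed simp
next
  assume "s \<simeq> t"
  then show "hurwitz_equivalent (sym_group n) s t"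
    unfolding hurwitz_equivalent_def
  proof (induction rule: equivclp_induct)
    case (step y z)
    have y: "set y \<subseteq> swaps {1..n}" using hurwitz_eq_swaps[OF step(1) assms] .
    then have "\<exists>k. hurwitz_move (sym_group n) k y z \<or> hurwitz_move (sym_group n) k z y"
      using step(2) hurwitz_move_of_step hurwitz_step_swaps by metis
    with step.IH show ?case by (rule rtranclp.rtrancl_into_rtrancl)
  qed simp
qed

lemma is_transposition_of_swaps:
  assumes "t \<in> swaps {1..n}" "t y \<noteq> y"
  shows "is_transposition_of n t {y, t y}"
proof -
  have "y \<in> {1..n}" using assms swaps_fixes_outside by metis
  moreover from this have "t y \<in> {1..n}" using swaps_apply_mem assms(1) by metis
  ultimately show ?thesis
    unfolding is_transposition_of_def using assms swaps_eq_transpose[OF assms] by metis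
qed

lemma is_transposition_of_support: "is_transposition_of n t e \<Longrightarrow> e = {z. t z \<noteq> z}"
  by (auto simp: is_transposition_of_def transpose_def)

lemma conn_closed:
  assumes "set F \<subseteq> swaps S" "conn F x y" "x \<in> S"
  shows "y \<in> S"
  using assms(2,3)
  by (induction rule: rtranclp_induct) (use assms(1) in \<open>auto simp: letter_step_def swaps_apply_mem\<close>)

lemma edge_iff_letter_step:
  assumes "set F \<subseteq> swaps {1..n}"
  shows "{x, y} \<in> snd (fact_graph n F) \<longleftrightarrow> x \<noteq> y \<and> letter_step F x y"
proof
  assume "{x, y} \<in> snd (fact_graph n F)"
  then obtain k where k: "k < length F" "is_transposition_of n (F ! k) {x, y}"
    by (auto simp: fact_graph_def)
  then have "x \<noteq> y \<and> (F ! k) x = y"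
    by (auto simp: is_transposition_of_def doubleton_eq_iff)
  then show "x \<noteq> y \<and> letter_step F x y"
    using nth_mem[OF k(1)] by (auto simp: letter_step_def)
next
  assume "x \<noteq> y \<and> letter_step F x y"
  then obtain t where t: "t \<in> set F" "t x = y" "t x \<noteq> x" by (auto simp: letter_step_def)
  then obtain k where "k < length F" "F ! k = t" by (auto simp: in_set_conv_nth)
  moreover have "is_transposition_of n t {x, y}"
    using is_transposition_of_swaps[of t n x] t assms by blast
  ultimately show "{x, y} \<in> snd (fact_graph n F)"
    by (auto simp: fact_graph_def)
qed

lemma reachable_fact_graph:
  assumes "set F \<subseteq> swaps {1..n}"
  shows "reachable (fact_graph n F) = {(u, v). u \<in> {1..n} \<and> v \<in> {1..n} \<and> conn F u v}"
proof -
  have "(\<lambda>x y. {x, y} \<in> snd (fact_graph n F)) = (\<lambda>x y. letter_step F x y \<and> x \<noteq> y)"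
    using edge_iff_letter_step[OF assms] by auto
  then have "(\<lambda>x y. {x, y} \<in> snd (fact_graph n F))\<^sup>*\<^sup>* = conn F"
    using rtranclp_r_diff_Id[of "letter_step F"] by (simp add: inf_fun_def)
  then show ?thesis by (simp add: reachable_def fact_graph_def)
qed

lemma equiv_reachable:
  assumes "set F \<subseteq> swaps {1..n}"
  shows "equiv {1..n} (reachable (fact_graph n F))"
  unfolding reachable_fact_graph[OF assms]
  by (intro equivI) (auto simp: refl_on_def intro!: symI transI intro: conn_sym[OF assms] rtranclp_trans)

definition induced_component :: "nat \<Rightarrow> (nat \<Rightarrow> nat) list \<Rightarrow> nat set \<Rightarrow> ugraph" where
  "induced_component n F C = (C, {e \<in> snd (fact_graph n F). e \<subseteq> C})"

lemma connected_components_fact_graph: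
  "connected_components (fact_graph n F) =
     induced_component n F ` ({1..n} // reachable (fact_graph n F))"
  by (simp add: connected_components_def induced_component_def fact_graph_def)

text \<open>
  A factor represents at most one edge, namely the set of points that it moves. So the sum of the edge
  weights counts each factor with an edge inside the component once.
\<close>

lemma component_weight_eq_weight:
  assumes F: "set F \<subseteq> swaps {1..n}" and x: "x \<in> {1..n}"
  shows "component_weight n F (induced_component n F (reachable (fact_graph n F) `` {x})) = weight F x"
proof -
  define C where "C = reachable (fact_graph n F) `` {x}"
  have C: "y \<in> C \<longleftrightarrow> conn F x y" for y
    using reachable_fact_graph[OF F] x conn_closed[OF F] by (auto simp: C_def)
  define E where "E = {e \<in> snd (fact_graph n F). e \<subseteq> C}"
  define K where "K e = {k. k < length F \<and> is_transposition_of n (F ! k) e}" for e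
  have "E \<subseteq> Pow {1..n}"
    by (auto simp: E_def fact_graph_def is_transposition_of_def)
  then have "finite E" by (rule finite_subset) simp
  moreover have "K e \<inter> K e' = {}" if "e \<noteq> e'" for e e'
    using that is_transposition_of_support unfolding K_def by blast
  ultimately have "(\<Sum>e \<in> E. card (K e)) = card (\<Union>e \<in> E. K e)"
    by (intro card_UN_disjoint[symmetric]) (auto simp: K_def)
  also have "(\<Union>e \<in> E. K e) = {k. k < length F \<and> (\<exists>y. (F ! k) y \<noteq> y \<and> conn F x y)}"
  proof (intro equalityI subsetI)
    fix k assume "k \<in> (\<Union>e \<in> E. K e)"
    then obtain e where e: "e \<subseteq> C" "k < length F" "is_transposition_of n (F ! k) e"
      by (auto simp: E_def K_def)
    then obtain i j where "i \<noteq> j" "e = {i, j}" "F ! k = transpose i j"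
      by (auto simp: is_transposition_of_def)
    then have "(F ! k) i \<noteq> i" "i \<in> C" using e(1) by auto
    then show "k \<in> {k. k < length F \<and> (\<exists>y. (F ! k) y \<noteq> y \<and> conn F x y)}"
      using e(2) C by blast
  next
    fix k assume "k \<in> {k. k < length F \<and> (\<exists>y. (F ! k) y \<noteq> y \<and> conn F x y)}"
    then obtain y where k: "k < length F" and y: "(F ! k) y \<noteq> y" "conn F x y" by blast
    have t: "is_transposition_of n (F ! k) {y, (F ! k) y}"
      using is_transposition_of_swaps[of "F ! k" n y] y(1) F k nth_mem by blast
    have "conn F x ((F ! k) y)"
      using y(2) conn_letter[OF nth_mem[OF k]] by (rule rtranclp_trans)
    then have "{y, (F ! k) y} \<in> E"
      using t k y(2) C by (auto simp: E_def fact_graph_def)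
    then show "k \<in> (\<Union>e \<in> E. K e)" using t k by (auto simp: K_def)
  qed
  also have "card \<dots> = weight F x"
    by (simp add: weight_def length_filter_conv_card)
  finally show ?thesis
    by (simp add: component_weight_def induced_component_def edge_weight_def C_def E_def K_def)
qed

text \<open>
  A component is determined by its vertex set, so the numberings and \<open>\<pi>\<close> only say that the two
  families of vertex sets coincide, with equal weights; points outside \<open>{1..n}\<close> are isolated and
  have weight 0 for both words. Conversely, one numbering of the common vertex sets serves for both
  graphs, with \<open>\<pi>\<close> the identity.
\<close>

lemma same_components_iff:
  assumes F1: "set F1 \<subseteq> swaps {1..n}" and F2: "set F2 \<subseteq> swaps {1..n}"
  shows "(\<exists>(d::nat) (G1 :: nat \<Rightarrow> ugraph) (G2 :: nat \<Rightarrow> ugraph).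
       bij_betw G1 {1..d} (connected_components (fact_graph n F1)) \<and>
       bij_betw G2 {1..d} (connected_components (fact_graph n F2)) \<and>
       (\<exists>\<pi>. \<pi> permutes {1..d} \<and>
          (\<forall>i \<in> {1..d}.
             fst (G1 i) = fst (G2 (\<pi> i)) \<and>
             component_weight n F1 (G1 i) = component_weight n F2 (G2 (\<pi> i)))))
     \<longleftrightarrow> conn F1 = conn F2 \<and> weight F1 = weight F2" (is "?L \<longleftrightarrow> ?R")
proof
  assume ?L
  then obtain d :: nat and G1 G2 :: "nat \<Rightarrow> ugraph" and \<pi> where
    G1: "bij_betw G1 {1..d} (connected_components (fact_graph n F1))" and
    G2: "bij_betw G2 {1..d} (connected_components (fact_graph n F2))" and
    \<pi>: "\<pi> permutes {1..d}" and
    eq: "\<And>i. i \<in> {1..d} \<Longrightarrow> fst (G1 i) = fst (G2 (\<pi> i))"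
      "\<And>i. i \<in> {1..d} \<Longrightarrow> component_weight n F1 (G1 i) = component_weight n F2 (G2 (\<pi> i))"
    by blast
  let ?R1 = "reachable (fact_graph n F1)" and ?R2 = "reachable (fact_graph n F2)"
  have same: "?R1 `` {u} = ?R2 `` {u} \<and> weight F1 u = weight F2 u" if u: "u \<in> {1..n}" for u
  proof -
    let ?C = "?R1 `` {u}"
    have "induced_component n F1 ?C \<in> connected_components (fact_graph n F1)"
      unfolding connected_components_fact_graph by (intro imageI quotientI u)
    then obtain i where i: "i \<in> {1..d}" "G1 i = induced_component n F1 ?C"
      using G1 by (metis bij_betw_imp_surj_on imageE)
    have "\<pi> i \<in> {1..d}" using \<pi> i(1) by (metis permutes_in_image)
    then have "G2 (\<pi> i) \<in> connected_components (fact_graph n F2)"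
      using G2 by (metis bij_betwE)
    then obtain w where w: "G2 (\<pi> i) = induced_component n F2 (?R2 `` {w})"
      by (auto simp: connected_components_fact_graph quotient_def)
    have C: "?C = ?R2 `` {w}" using eq(1)[OF i(1)] i(2) w by (simp add: induced_component_def)
    moreover have "u \<in> ?C" using equiv_class_self[OF equiv_reachable[OF F1] u] .
    ultimately have "?R2 `` {w} = ?R2 `` {u}"
      using equiv_class_eq[OF equiv_reachable[OF F2], of w u] by simp
    then have "?C = ?R2 `` {u}" "G2 (\<pi> i) = induced_component n F2 (?R2 `` {u})"
      using C w by simp_all
    then show ?thesis
      using eq(2)[OF i(1)] i(2) component_weight_eq_weight[OF F1 u] component_weight_eq_weight[OF F2 u]
      by simp
  qed
  have "conn F1 u v \<longleftrightarrow> conn F2 u v" for u v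
  proof (cases "u \<in> {1..n}")
    case True
    then have "(u, v) \<in> ?R1 \<longleftrightarrow> (u, v) \<in> ?R2" using same by (metis Image_singleton_iff)
    then show ?thesis
      using True conn_closed[OF F1, of u v] conn_closed[OF F2, of u v]
      unfolding reachable_fact_graph[OF F1] reachable_fact_graph[OF F2] by fastforce
  next
    case False
    then have "v = u" if "conn F u v" "set F \<subseteq> swaps {1..n}" for F
      using that conn_fixed[of F u v] swaps_fixes_outside[of _ "{1..n}" u] by blast
    then show ?thesis using F1 F2 by blast
  qed
  moreover have "weight F1 u = weight F2 u" for u
  proof (cases "u \<in> {1..n}")
    case False
    then have "weight F u = 0" if "set F \<subseteq> swaps {1..n}" for F
      using that swaps_fixes_outside[of _ "{1..n}" u] by (intro weight_fixed) blast
    then show ?thesis using F1 F2 by simp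
  qed (use same in blast)
  ultimately show ?R by (intro conjI ext)
next
  assume R: ?R
  define Q where "Q = {1..n} // reachable (fact_graph n F1)"
  have Q2: "Q = {1..n} // reachable (fact_graph n F2)"
    using R unfolding Q_def reachable_fact_graph[OF F1] reachable_fact_graph[OF F2] by simp
  have "finite Q" unfolding Q_def
    by (rule finite_quotient) (auto simp: reachable_fact_graph[OF F1])
  then obtain h where h: "bij_betw h {1..card Q} Q" using ex_bij_betw_nat_finite_1 by blast
  have bij: "bij_betw (induced_component n F \<circ> h) {1..card Q} (connected_components (fact_graph n F))"
    if "Q = {1..n} // reachable (fact_graph n F)" for F
    using h
  proof (rule bij_betw_trans)
    show "bij_betw (induced_component n F) Q (connected_components (fact_graph n F))"
      unfolding connected_components_fact_graph that
      by (intro inj_on_imp_bij_betw inj_onI) (simp add: induced_component_def)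
  qed
  have "component_weight n F1 (induced_component n F1 (h i)) =
        component_weight n F2 (induced_component n F2 (h i))" if "i \<in> {1..card Q}" for i
  proof -
    have "h i \<in> Q" using h that by (metis bij_betwE)
    then obtain u where u: "u \<in> {1..n}" "h i = reachable (fact_graph n F1) `` {u}"
      by (auto simp: Q_def elim: quotientE)
    moreover have "reachable (fact_graph n F1) = reachable (fact_graph n F2)"
      using R unfolding reachable_fact_graph[OF F1] reachable_fact_graph[OF F2] by simp
    ultimately show ?thesis
      using component_weight_eq_weight[OF F1 u(1)] component_weight_eq_weight[OF F2 u(1)] R by simp
  qed
  then show ?L
    using bij[OF Q_def] bij[OF Q2]
    by (intro exI[of _ "card Q"] exI[of _ "induced_component n F1 \<circ> h"]
          exI[of _ "induced_component n F2 \<circ> h"] conjI exI[of _ id] permutes_id)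
      (simp_all add: induced_component_def)
qed

theorem theorem3p4:
  fixes n m :: nat and F\<^sub>1 F\<^sub>2 :: "(nat \<Rightarrow> nat) list"
  assumes "n \<ge> 1" and "m \<ge> 1"
    and "length F\<^sub>1 = m" and "length F\<^sub>2 = m"
    and "factorization (sym_group n) \<one>\<^bsub>sym_group n\<^esub> F\<^sub>1"
    and "factorization (sym_group n) \<one>\<^bsub>sym_group n\<^esub> F\<^sub>2"
    and "\<forall>\<Gamma> \<in> set F\<^sub>1. is_transposition n \<Gamma> \<or> \<Gamma> = \<one>\<^bsub>sym_group n\<^esub>"
    and "\<forall>\<Gamma> \<in> set F\<^sub>2. is_transposition n \<Gamma> \<or> \<Gamma> = \<one>\<^bsub>sym_group n\<^esub>"
  shows "hurwitz_equivalent (sym_group n) F\<^sub>1 F\<^sub>2 \<longleftrightarrow>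
    (\<exists>(d::nat) (G\<^sub>1 :: nat \<Rightarrow> ugraph) (G\<^sub>2 :: nat \<Rightarrow> ugraph).
       bij_betw G\<^sub>1 {1..d} (connected_components (fact_graph n F\<^sub>1)) \<and>
       bij_betw G\<^sub>2 {1..d} (connected_components (fact_graph n F\<^sub>2)) \<and>
       (\<exists>\<pi>. \<pi> permutes {1..d} \<and>
          (\<forall>i \<in> {1..d}.
             fst (G\<^sub>1 i) = fst (G\<^sub>2 (\<pi> i)) \<and>
             component_weight n F\<^sub>1 (G\<^sub>1 i) = component_weight n F\<^sub>2 (G\<^sub>2 (\<pi> i)))))"
proof -
  have swaps: "\<Gamma> \<in> swaps {1..n}" if "is_transposition n \<Gamma> \<or> \<Gamma> = \<one>\<^bsub>sym_group n\<^esub>" for \<Gamma>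
    using that
  proof
    assume "\<Gamma> = \<one>\<^bsub>sym_group n\<^esub>"
    then have "\<Gamma> = transpose 1 1" by (simp add: sym_group_one)
    then show ?thesis using assms(1) unfolding swaps_def by force
  next
    assume "is_transposition n \<Gamma>"
    then show ?thesis
      unfolding is_transposition_def is_transposition_of_def swaps_def by blast
  qed
  have F: "set F\<^sub>1 \<subseteq> swaps {1..n}" "set F\<^sub>2 \<subseteq> swaps {1..n}"
    using assms(7,8) swaps by blast+
  have prod: "foldr (\<circ>) F\<^sub>1 id = id" "foldr (\<circ>) F\<^sub>2 id = id"
    using assms(5,6) by (simp_all add: factorization_def sym_group_mult sym_group_one)
  have len: "length F\<^sub>1 = length F\<^sub>2" using assms(3,4) by simp
  have "F\<^sub>1 \<simeq> F\<^sub>2 \<longleftrightarrow> conn F\<^sub>1 = conn F\<^sub>2 \<and> weight F\<^sub>1 = weight F\<^sub>2"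
  proof (intro iffI conjI)
    assume eq: "F\<^sub>1 \<simeq> F\<^sub>2"
    show "conn F\<^sub>1 = conn F\<^sub>2" by (rule hurwitz_eq_conn[OF eq F(1)])
    show "weight F\<^sub>1 = weight F\<^sub>2" by (rule hurwitz_eq_weight[OF eq F(1)])
  next
    assume inv: "conn F\<^sub>1 = conn F\<^sub>2 \<and> weight F\<^sub>1 = weight F\<^sub>2"
    show "F\<^sub>1 \<simeq> F\<^sub>2"
      by (rule hurwitz_eq_if_same_invariants[OF F len prod conjunct1[OF inv] conjunct2[OF inv]])
  qed
  then show ?thesis
    unfolding hurwitz_equivalent_iff[OF F(1)] same_components_iff[OF F] .
qed

end
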